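(* The function $$\begin{aligned}\phi(x,t)=\;&\frac{f(x-(t-a))+f(x+(t-a))}{2}\\&-2\int_{x+(t-a)}^{x-(t-a)}\frac{t(1+a^2+w^2)+a(x^2-2wx-t^2-1)}{(1+x^2-t^2)(1-a^2+w^2)^2}\,f(w)\,dw\\&-\frac12\int_{x+(t-a)}^{x-(t-a)}\frac{(1-x^2+t^2)(1+a^2-w^2)-4at+4wx}{(1+x^2-t^2)(1-a^2+w^2)}\,g(w)\,dw\end{aligned}$$ satisfies $$-\partial_{tt}\phi+\partial_{xx}\phi+\frac{8}{(1+x^2-t^2)^2}\,\phi=0 .$$
   Context: Here $(x,t)$ are the space and time coordinates of two-dimensional Minkowski space with metric of signature $(-,+)$, $a$ is the initial time, and $f$, $g$ are the initial data prescribed at $t=a$ for $\phi$ and $\partial_t\phi$ respectively. The equation is the case $n=2$ of $\Box\phi+\frac{n(n+2)}{(1+x\cdot x)^2}\phi=0$ on $n$-dimensional Minkowski space, $\Box$ being the D'Alembertian. The integrals are oriented: $\int_\beta^\alpha=-\int_\alpha^\beta$. *)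

theory Defs
  imports "HOL-Analysis.Analysis"
begin

text \<open>
  The integrals are oriented (\<open>interval_lebesgue_integral\<close>), so \<open>t < a\<close> is allowed.
\<close>

definition phi :: "real \<Rightarrow> (real \<Rightarrow> real) \<Rightarrow> (real \<Rightarrow> real) \<Rightarrow> real \<Rightarrow> real \<Rightarrow> real" where
  "phi a f g x t =
     (f (x - (t - a)) + f (x + (t - a))) / 2
     - 2 * (LBINT w = x + (t - a)..x - (t - a).
         (t * (1 + a^2 + w^2) + a * (x^2 - 2 * w * x - t^2 - 1))
           / ((1 + x^2 - t^2) * (1 - a^2 + w^2)^2) * f w)
     - 1 / 2 * (LBINT w = x + (t - a)..x - (t - a).
         ((1 - x^2 + t^2) * (1 + a^2 - w^2) - 4 * a * t + 4 * w * x)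
           / ((1 + x^2 - t^2) * (1 - a^2 + w^2)) * g w)"

text \<open>
  \<open>deriv\<close> is total, so a second derivative is only meaningful if the function is
  differentiable near the point; both this and the existence of the second derivative
  are part of the relation.
\<close>

definition has_second_derivative :: "(real \<Rightarrow> real) \<Rightarrow> real \<Rightarrow> real \<Rightarrow> bool" where
  "has_second_derivative h D s \<longleftrightarrow>
     (\<forall>\<^sub>F r in nhds s. h differentiable (at r)) \<and> (deriv h has_real_derivative D) (at s)"

end

theory Submission
  imports Defs
begin

text \<open>
  In the variable \<open>w\<close> both kernels are quadratic polynomials, over a function of \<open>w\<close> alone, whose
  coefficients have the form \<open>(p t + q x + r (x\<^sup>2 - t\<^sup>2 - 1)) / (1 + x\<^sup>2 - t\<^sup>2)\<close>. All such coefficients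
  solve the equation. Hence \<open>\<phi>\<close> is a sum of products of a solution \<open>c (x, t)\<close> and a travelling wave
  \<open>H (x \<plusminus> (t - a))\<close>, and applying the operator to such a product leaves only the first-order term
  \<open>2 (c\<^sub>x \<mp> c\<^sub>t) H'\<close>. For the \<open>g\<close>-kernel these terms cancel along each characteristic, and for the
  \<open>f\<close>-kernel they cancel the potential term of the d'Alembert part.
\<close>

section \<open>Calculus of second derivatives at a point\<close>

text \<open>Near \<open>s\<close> the explicit derivative \<open>h'\<close> pins down
  \<open>deriv h\<close>, and differentiability at \<open>s\<close> depends only on the values near
  \<open>s\<close>, so \<open>D\<close> carries over from \<open>h'\<close> to
  \<open>deriv h\<close>.\<close>

lemma has_second_derivativeI:
  assumes "\<forall>\<^sub>F r in nhds s. (h has_real_derivative h' r) (at r)"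
    and "(h' has_real_derivative D) (at s)"
  shows "has_second_derivative h D s"
proof -
  have "\<forall>\<^sub>F r in nhds s. deriv h r = h' r"
    using assms(1) by eventually_elim (rule DERIV_imp_deriv)
  then have "(deriv h has_real_derivative D) (at s)"
    using assms(2) DERIV_cong_ev[of s s "deriv h" h' D D] by simp
  moreover have "\<forall>\<^sub>F r in nhds s. h differentiable (at r)"
    using assms(1) by eventually_elim (auto simp: real_differentiable_def)
  ultimately show ?thesis
    by (simp add: has_second_derivative_def)
qed

lemma has_second_derivativeD:
  assumes "has_second_derivative h D s"
  shows "\<forall>\<^sub>F r in nhds s. (h has_real_derivative deriv h r) (at r)"
    and "(deriv h has_real_derivative D) (at s)"
  using assms
  by (auto simp: has_second_derivative_def real_differentiable_def DERIV_imp_deriv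
      elim!: eventually_mono)

lemma has_second_derivative_add:
  assumes "has_second_derivative h D s" "has_second_derivative k E s"
  shows "has_second_derivative (\<lambda>r. h r + k r) (D + E) s"
proof (rule has_second_derivativeI)
  show "\<forall>\<^sub>F r in nhds s. ((\<lambda>r. h r + k r) has_real_derivative deriv h r + deriv k r) (at r)"
    using has_second_derivativeD(1)[OF assms(1)] has_second_derivativeD(1)[OF assms(2)]
    by eventually_elim (rule DERIV_add)
  show "((\<lambda>r. deriv h r + deriv k r) has_real_derivative D + E) (at s)"
    using assms by (intro DERIV_add has_second_derivativeD(2))
qed

lemma has_second_derivative_mult:
  assumes "\<forall>\<^sub>F r in nhds s. (h has_real_derivative h' r) (at r)"
    and "(h' has_real_derivative D) (at s)"
    and "\<forall>\<^sub>F r in nhds s. (k has_real_derivative k' r) (at r)"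
    and "(k' has_real_derivative E) (at s)"
  shows "has_second_derivative (\<lambda>r. h r * k r) (D * k s + 2 * h' s * k' s + h s * E) s"
proof (rule has_second_derivativeI)
  show "\<forall>\<^sub>F r in nhds s. ((\<lambda>r. h r * k r) has_real_derivative h' r * k r + k' r * h r) (at r)"
    using assms(1,3) by eventually_elim (rule DERIV_mult)
  have "(h has_real_derivative h' s) (at s)" "(k has_real_derivative k' s) (at s)"
    using assms(1,3) by (auto dest: eventually_nhds_x_imp_x)
  then show "((\<lambda>r. h' r * k r + k' r * h r) has_real_derivative
      D * k s + 2 * h' s * k' s + h s * E) (at s)"
    using assms(2,4) by (auto intro!: derivative_eq_intros simp: algebra_simps)
qed

lemma has_second_derivative_cmult:
  assumes "has_second_derivative h D s"
  shows "has_second_derivative (\<lambda>r. b * h r) (b * D) s"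
  using has_second_derivative_mult[OF _ _ has_second_derivativeD[OF assms],
      of "\<lambda>_. b" "\<lambda>_. 0" 0] by simp

lemma has_second_derivative_transform:
  assumes "has_second_derivative h D s" "\<forall>\<^sub>F r in nhds s. k r = h r"
  shows "has_second_derivative k D s"
proof (rule has_second_derivativeI)
  \<comment> \<open>To equate derivatives at a nearby point \<open>r\<close>, the functions must
    agree around \<open>r\<close> and not only at \<open>r\<close>.\<close>
  have "\<forall>\<^sub>F r in nhds s. \<forall>\<^sub>F r' in nhds r. k r' = h r'"
    using assms(2) by (simp add: eventually_eventually)
  then show "\<forall>\<^sub>F r in nhds s. (k has_real_derivative deriv h r) (at r)"
    using has_second_derivativeD(1)[OF assms(1)]
    by eventually_elim (metis DERIV_cong_ev)
  show "(deriv h has_real_derivative D) (at s)"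
    by (rule has_second_derivativeD(2)[OF assms(1)])
qed

section \<open>Residual of the Klein-Gordon operator at a point\<close>

text \<open>Existence of both second derivatives and the value of the operator are kept together, so
  that existence passes through sums along with the value. A nonzero \<open>R\<close> is allowed
  because single summands of the solution do not solve the equation; only their residuals
  cancel.\<close>

definition kg_residual :: "(real \<Rightarrow> real \<Rightarrow> real) \<Rightarrow> real \<Rightarrow> real \<Rightarrow> real \<Rightarrow> bool" where
  "kg_residual \<Phi> x t R \<longleftrightarrow> (\<exists>\<Phi>_tt \<Phi>_xx.
     has_second_derivative (\<lambda>s. \<Phi> x s) \<Phi>_tt t \<and>
     has_second_derivative (\<lambda>y. \<Phi> y t) \<Phi>_xx x \<and>
     - \<Phi>_tt + \<Phi>_xx + 8 / (1 + x^2 - t^2)^2 * \<Phi> x t = R)"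

lemma kg_residual_add:
  assumes "kg_residual \<Phi> x t R" "kg_residual \<Psi> x t S"
  shows "kg_residual (\<lambda>y s. \<Phi> y s + \<Psi> y s) x t (R + S)"
proof -
  obtain A B C D where
    \<Phi>: "has_second_derivative (\<lambda>s. \<Phi> x s) A t" "has_second_derivative (\<lambda>y. \<Phi> y t) B x"
      "- A + B + 8 / (1 + x^2 - t^2)^2 * \<Phi> x t = R" and
    \<Psi>: "has_second_derivative (\<lambda>s. \<Psi> x s) C t" "has_second_derivative (\<lambda>y. \<Psi> y t) D x"
      "- C + D + 8 / (1 + x^2 - t^2)^2 * \<Psi> x t = S"
    using assms unfolding kg_residual_def by blast
  show ?thesis
    unfolding kg_residual_def \<Phi>(3)[symmetric] \<Psi>(3)[symmetric]
    using has_second_derivative_add[OF \<Phi>(1) \<Psi>(1)] has_second_derivative_add[OF \<Phi>(2) \<Psi>(2)]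
    by (intro exI conjI) (assumption | simp add: distrib_left)+
qed

lemma kg_residual_cmult:
  assumes "kg_residual \<Phi> x t R"
  shows "kg_residual (\<lambda>y s. b * \<Phi> y s) x t (b * R)"
proof -
  obtain A B where
    \<Phi>: "has_second_derivative (\<lambda>s. \<Phi> x s) A t" "has_second_derivative (\<lambda>y. \<Phi> y t) B x"
      "- A + B + 8 / (1 + x^2 - t^2)^2 * \<Phi> x t = R"
    using assms unfolding kg_residual_def by blast
  show ?thesis
    unfolding kg_residual_def \<Phi>(3)[symmetric]
    using has_second_derivative_cmult[OF \<Phi>(1), of b] has_second_derivative_cmult[OF \<Phi>(2), of b]
    by (intro exI conjI) (assumption | simp add: distrib_left right_diff_distrib)+
qed

lemma kg_residual_diff:
  assumes "kg_residual \<Phi> x t R" "kg_residual \<Psi> x t S"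
  shows "kg_residual (\<lambda>y s. \<Phi> y s - \<Psi> y s) x t (R - S)"
  using kg_residual_add[OF assms(1) kg_residual_cmult[OF assms(2), of "-1"]] by simp

text \<open>The operator contains only pure second derivatives, so agreement along the two
  coordinate lines through \<open>(x, t)\<close> suffices.\<close>

lemma kg_residual_transform:
  assumes "kg_residual \<Phi> x t R"
    and "\<forall>\<^sub>F s in nhds t. \<Psi> x s = \<Phi> x s" "\<forall>\<^sub>F y in nhds x. \<Psi> y t = \<Phi> y t"
  shows "kg_residual \<Psi> x t R"
proof -
  obtain A B where
    "has_second_derivative (\<lambda>s. \<Phi> x s) A t" "has_second_derivative (\<lambda>y. \<Phi> y t) B x"
    and R: "- A + B + 8 / (1 + x^2 - t^2)^2 * \<Phi> x t = R"
    using assms unfolding kg_residual_def by blast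
  then have "has_second_derivative (\<lambda>s. \<Psi> x s) A t" "has_second_derivative (\<lambda>y. \<Psi> y t) B x"
    using assms(2,3) by (blast intro: has_second_derivative_transform)+
  moreover have "\<Psi> x t = \<Phi> x t"
    using assms(2) by (rule eventually_nhds_x_imp_x)
  ultimately show ?thesis
    using R unfolding kg_residual_def by auto
qed

section \<open>Rational solutions of the equation\<close>

text \<open>With \<open>D = 1 + x^2 - t^2\<close>, the triple \<open>T = 2 t / D\<close>,
  \<open>X = 2 x / D\<close>, \<open>Z = (x^2 - t^2 - 1) / D\<close> is the inverse stereographic
  projection onto the hyperboloid \<open>- T^2 + X^2 + Z^2 = 1\<close>, that is, two-dimensional de
  Sitter space. These coefficients are the restrictions of linear forms to it, the analogues of
  spherical harmonics of degree one.\<close>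

definition rcoeff :: "real \<Rightarrow> real \<Rightarrow> real \<Rightarrow> real \<Rightarrow> real \<Rightarrow> real" where
  "rcoeff p q r x t = (p * t + q * x + r * (x^2 - t^2 - 1)) / (1 + x^2 - t^2)"

definition rcoeff_t :: "real \<Rightarrow> real \<Rightarrow> real \<Rightarrow> real \<Rightarrow> real \<Rightarrow> real" where
  "rcoeff_t p q r x t = (p - 2 * r * t) / (1 + x^2 - t^2)
     + 2 * t * (p * t + q * x + r * (x^2 - t^2 - 1)) / (1 + x^2 - t^2)^2"

definition rcoeff_x :: "real \<Rightarrow> real \<Rightarrow> real \<Rightarrow> real \<Rightarrow> real \<Rightarrow> real" where
  "rcoeff_x p q r x t = (q + 2 * r * x) / (1 + x^2 - t^2)
     - 2 * x * (p * t + q * x + r * (x^2 - t^2 - 1)) / (1 + x^2 - t^2)^2"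

lemma rcoeff_has_derivative_t:
  assumes "1 + x^2 - t^2 \<noteq> 0"
  shows "(rcoeff p q r x has_real_derivative rcoeff_t p q r x t) (at t)"
  unfolding rcoeff_def[abs_def] rcoeff_t_def using assms
  by (auto intro!: derivative_eq_intros) (simp add: divide_simps, simp add: algebra_simps power2_eq_square)

lemma rcoeff_has_derivative_x:
  assumes "1 + x^2 - t^2 \<noteq> 0"
  shows "((\<lambda>y. rcoeff p q r y t) has_real_derivative rcoeff_x p q r x t) (at x)"
  unfolding rcoeff_def[abs_def] rcoeff_x_def using assms
  by (auto intro!: derivative_eq_intros) (simp add: divide_simps, simp add: algebra_simps power2_eq_square)

definition rcoeff_tt :: "real \<Rightarrow> real \<Rightarrow> real \<Rightarrow> real \<Rightarrow> real \<Rightarrow> real" where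
  "rcoeff_tt p q r x t = - 2 * r / (1 + x^2 - t^2) + 4 * t * (p - 2 * r * t) / (1 + x^2 - t^2)^2
     + 2 * (p * t + q * x + r * (x^2 - t^2 - 1)) / (1 + x^2 - t^2)^2
     + 8 * t^2 * (p * t + q * x + r * (x^2 - t^2 - 1)) / (1 + x^2 - t^2)^3"

definition rcoeff_xx :: "real \<Rightarrow> real \<Rightarrow> real \<Rightarrow> real \<Rightarrow> real \<Rightarrow> real" where
  "rcoeff_xx p q r x t = 2 * r / (1 + x^2 - t^2) - 4 * x * (q + 2 * r * x) / (1 + x^2 - t^2)^2
     - 2 * (p * t + q * x + r * (x^2 - t^2 - 1)) / (1 + x^2 - t^2)^2
     + 8 * x^2 * (p * t + q * x + r * (x^2 - t^2 - 1)) / (1 + x^2 - t^2)^3"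

lemma rcoeff_t_has_derivative:
  assumes "1 + x^2 - t^2 \<noteq> 0"
  shows "(rcoeff_t p q r x has_real_derivative rcoeff_tt p q r x t) (at t)"
proof -
  \<comment> \<open>With denominator and numerator kept opaque, the remaining identity is rational
    in their values at \<open>t\<close> and need not be expanded.\<close>
  define D where "D s = 1 + x^2 - s^2" for s :: real
  define N where "N s = p * s + q * x + r * (x^2 - s^2 - 1)" for s :: real
  have D: "(D has_real_derivative - 2 * t) (at t)" "D t \<noteq> 0"
    using assms unfolding D_def by (auto intro!: derivative_eq_intros)
  have N: "(N has_real_derivative p - 2 * r * t) (at t)"
    unfolding N_def by (auto intro!: derivative_eq_intros)
  have "((\<lambda>s. (p - 2 * r * s) / D s + 2 * s * N s / (D s)^2) has_real_derivative
      - 2 * r / D t + 4 * t * (p - 2 * r * t) / (D t)^2 + 2 * N t / (D t)^2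
      + 8 * t^2 * N t / (D t)^3) (at t)"
    using D(2)
    by (auto intro!: derivative_eq_intros D N)
      (simp add: divide_simps, simp add: algebra_simps eval_nat_numeral)
  then show ?thesis
    unfolding rcoeff_t_def[abs_def] rcoeff_tt_def D_def N_def .
qed

lemma rcoeff_x_has_derivative:
  assumes "1 + x^2 - t^2 \<noteq> 0"
  shows "((\<lambda>y. rcoeff_x p q r y t) has_real_derivative rcoeff_xx p q r x t) (at x)"
proof -
  define D where "D y = 1 + y^2 - t^2" for y :: real
  define N where "N y = p * t + q * y + r * (y^2 - t^2 - 1)" for y :: real
  have D: "(D has_real_derivative 2 * x) (at x)" "D x \<noteq> 0"
    using assms unfolding D_def by (auto intro!: derivative_eq_intros)
  have N: "(N has_real_derivative q + 2 * r * x) (at x)"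
    unfolding N_def by (auto intro!: derivative_eq_intros)
  have "((\<lambda>y. (q + 2 * r * y) / D y - 2 * y * N y / (D y)^2) has_real_derivative
      2 * r / D x - 4 * x * (q + 2 * r * x) / (D x)^2 - 2 * N x / (D x)^2
      + 8 * x^2 * N x / (D x)^3) (at x)"
    using D(2)
    by (auto intro!: derivative_eq_intros D N)
      (simp add: divide_simps, simp add: algebra_simps eval_nat_numeral)
  then show ?thesis
    unfolding rcoeff_x_def[abs_def] rcoeff_xx_def D_def N_def .
qed

text \<open>Write \<open>D\<close> for the denominator and \<open>N\<close> for the numerator. Since
  \<open>x^2 - t^2 + 1 = D\<close>, the potential term and the cubic terms add up to
  \<open>8 * N / D^2\<close>; the lower-order terms then cancel by the same relation.\<close>

lemma rcoeff_solves:
  assumes "1 + x^2 - t^2 \<noteq> 0"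
  shows "- rcoeff_tt p q r x t + rcoeff_xx p q r x t + 8 / (1 + x^2 - t^2)^2 * rcoeff p q r x t = 0"
proof -
  define D where "D = 1 + x^2 - t^2"
  \<comment> \<open>Writing the reciprocal as a variable turns the claim into a consequence of the
    polynomial relations \<open>D * i = 1\<close> and \<open>D = 1 + x^2 - t^2\<close>.\<close>
  define i where "i = 1 / D"
  have i: "D * i = 1"
    using assms by (simp add: D_def i_def)
  have div: "u / D = u * i" "u / D^n = u * i^n" for u n
    by (simp_all add: i_def power_one_over)
  show ?thesis
    unfolding rcoeff_tt_def rcoeff_xx_def rcoeff_def D_def[symmetric] div
    using i D_def by algebra
qed

section \<open>Travelling waves and their products with rational solutions\<close>

lemma has_derivative_wave_t:
  assumes "(H has_real_derivative D) (at (x + \<sigma> * (t - a)))"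
  shows "((\<lambda>s. H (x + \<sigma> * (s - a))) has_real_derivative \<sigma> * D) (at t)"
proof -
  have "((\<lambda>s. x + \<sigma> * (s - a)) has_real_derivative \<sigma>) (at t)"
    by (auto intro!: derivative_eq_intros)
  from DERIV_chain2[of H D "\<lambda>s. x + \<sigma> * (s - a)", OF assms this] show ?thesis
    by (simp add: mult.commute)
qed

lemma has_derivative_wave_x:
  assumes "(H has_real_derivative D) (at (x + \<sigma> * (t - a)))"
  shows "((\<lambda>y. H (y + \<sigma> * (t - a))) has_real_derivative D) (at x)"
proof -
  have "((\<lambda>y. y + \<sigma> * (t - a)) has_real_derivative 1) (at x)"
    by (auto intro!: derivative_eq_intros)
  from DERIV_chain2[of H D "\<lambda>y. y + \<sigma> * (t - a)", OF assms this] show ?thesis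
    by simp
qed

lemma eventually_wave_t:
  fixes x \<sigma> t a :: real
  assumes "\<forall>\<^sub>F w in nhds (x + \<sigma> * (t - a)). P w"
  shows "\<forall>\<^sub>F s in nhds t. P (x + \<sigma> * (s - a))"
  using assms
  by (rule eventually_compose_filterlim) (intro tendsto_intros filterlim_ident)

lemma eventually_wave_x:
  fixes x \<sigma> t a :: real
  assumes "\<forall>\<^sub>F w in nhds (x + \<sigma> * (t - a)). P w"
  shows "\<forall>\<^sub>F y in nhds x. P (y + \<sigma> * (t - a))"
  using assms
  by (rule eventually_compose_filterlim) (intro tendsto_intros filterlim_ident)

text \<open>The wave part of the operator annihilates a travelling wave because
  \<open>\<sigma>^2 = 1\<close>, which leaves only the potential term.\<close>

lemma kg_residual_wave:
  assumes "\<sigma>^2 = 1"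
    and h: "\<forall>\<^sub>F w in nhds (x + \<sigma> * (t - a)). (h has_real_derivative h' w) (at w)"
    and h': "(h' has_real_derivative E) (at (x + \<sigma> * (t - a)))"
  shows "kg_residual (\<lambda>y s. h (y + \<sigma> * (s - a))) x t
    (8 / (1 + x^2 - t^2)^2 * h (x + \<sigma> * (t - a)))"
  unfolding kg_residual_def
proof (intro exI conjI)
  show "has_second_derivative (\<lambda>s. h (x + \<sigma> * (s - a))) (\<sigma> * (\<sigma> * E)) t"
  proof (rule has_second_derivativeI)
    show "\<forall>\<^sub>F s in nhds t. ((\<lambda>s. h (x + \<sigma> * (s - a))) has_real_derivative
        \<sigma> * h' (x + \<sigma> * (s - a))) (at s)"
      using eventually_wave_t[OF h] by eventually_elim (rule has_derivative_wave_t)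
    show "((\<lambda>s. \<sigma> * h' (x + \<sigma> * (s - a))) has_real_derivative \<sigma> * (\<sigma> * E)) (at t)"
      by (intro DERIV_cmult has_derivative_wave_t h')
  qed
  show "has_second_derivative (\<lambda>y. h (y + \<sigma> * (t - a))) E x"
  proof (rule has_second_derivativeI)
    show "\<forall>\<^sub>F y in nhds x. ((\<lambda>y. h (y + \<sigma> * (t - a))) has_real_derivative
        h' (y + \<sigma> * (t - a))) (at y)"
      using eventually_wave_x[OF h] by eventually_elim (rule has_derivative_wave_x)
    show "((\<lambda>y. h' (y + \<sigma> * (t - a))) has_real_derivative E) (at x)"
      by (intro has_derivative_wave_x h')
  qed
  show "- (\<sigma> * (\<sigma> * E)) + E + 8 / (1 + x^2 - t^2)^2 * h (x + \<sigma> * (t - a))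
      = 8 / (1 + x^2 - t^2)^2 * h (x + \<sigma> * (t - a))"
    using assms(1) by (simp add: power2_eq_square flip: mult.assoc)
qed

text \<open>In the product rule the second derivatives of the coefficient cancel the potential term
  by \<open>rcoeff_solves\<close>, and the two terms with \<open>E\<close> cancel by
  \<open>\<sigma>^2 = 1\<close>. The cross terms remain; they differentiate the coefficient along
  the line on which \<open>x + \<sigma> * (t - a)\<close> is constant.\<close>

lemma kg_residual_rcoeff_wave:
  assumes "\<sigma>^2 = 1" and nz: "1 + x^2 - t^2 \<noteq> 0"
    and h: "\<forall>\<^sub>F w in nhds (x + \<sigma> * (t - a)). (h has_real_derivative h' w) (at w)"
    and h': "(h' has_real_derivative E) (at (x + \<sigma> * (t - a)))"
  shows "kg_residual (\<lambda>y s. rcoeff p q r y s * h (y + \<sigma> * (s - a))) x t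
    (2 * (rcoeff_x p q r x t - \<sigma> * rcoeff_t p q r x t) * h' (x + \<sigma> * (t - a)))"
  unfolding kg_residual_def
proof (intro exI conjI)
  let ?w = "x + \<sigma> * (t - a)"
  have "((\<lambda>s. 1 + x^2 - s^2) \<longlongrightarrow> 1 + x^2 - t^2) (nhds t)"
    by (intro tendsto_intros filterlim_ident)
  from tendsto_imp_eventually_ne[OF this nz]
  have nz_t: "\<forall>\<^sub>F s in nhds t. 1 + x^2 - s^2 \<noteq> 0" .
  have "((\<lambda>y. 1 + y^2 - t^2) \<longlongrightarrow> 1 + x^2 - t^2) (nhds x)"
    by (intro tendsto_intros filterlim_ident)
  from tendsto_imp_eventually_ne[OF this nz]
  have nz_x: "\<forall>\<^sub>F y in nhds x. 1 + y^2 - t^2 \<noteq> 0" .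
  show "has_second_derivative (\<lambda>s. rcoeff p q r x s * h (x + \<sigma> * (s - a)))
      (rcoeff_tt p q r x t * h ?w + 2 * rcoeff_t p q r x t * (\<sigma> * h' ?w)
        + rcoeff p q r x t * (\<sigma> * (\<sigma> * E))) t"
  proof (rule has_second_derivative_mult)
    show "\<forall>\<^sub>F s in nhds t. (rcoeff p q r x has_real_derivative rcoeff_t p q r x s) (at s)"
      using nz_t by eventually_elim (rule rcoeff_has_derivative_t)
    show "\<forall>\<^sub>F s in nhds t. ((\<lambda>s. h (x + \<sigma> * (s - a))) has_real_derivative
        \<sigma> * h' (x + \<sigma> * (s - a))) (at s)"
      using eventually_wave_t[OF h] by eventually_elim (rule has_derivative_wave_t)
  qed (intro DERIV_cmult has_derivative_wave_t rcoeff_t_has_derivative nz h')+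
  show "has_second_derivative (\<lambda>y. rcoeff p q r y t * h (y + \<sigma> * (t - a)))
      (rcoeff_xx p q r x t * h ?w + 2 * rcoeff_x p q r x t * h' ?w + rcoeff p q r x t * E) x"
  proof (rule has_second_derivative_mult)
    show "\<forall>\<^sub>F y in nhds x. ((\<lambda>y. rcoeff p q r y t) has_real_derivative rcoeff_x p q r y t) (at y)"
      using nz_x by eventually_elim (rule rcoeff_has_derivative_x)
    show "\<forall>\<^sub>F y in nhds x. ((\<lambda>y. h (y + \<sigma> * (t - a))) has_real_derivative
        h' (y + \<sigma> * (t - a))) (at y)"
      using eventually_wave_x[OF h] by eventually_elim (rule has_derivative_wave_x)
  qed (intro has_derivative_wave_x rcoeff_x_has_derivative nz h')+
  let ?k = "8 / (1 + x^2 - t^2)^2"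
  have "?k * rcoeff p q r x t = rcoeff_tt p q r x t - rcoeff_xx p q r x t"
    using rcoeff_solves[OF nz, of p q r] by linarith
  then have "?k * (rcoeff p q r x t * h ?w) = (rcoeff_tt p q r x t - rcoeff_xx p q r x t) * h ?w"
    by (metis mult.assoc)
  moreover have "rcoeff p q r x t * (\<sigma> * (\<sigma> * E)) = rcoeff p q r x t * E"
    using assms(1) by (simp add: power2_eq_square flip: mult.assoc)
  ultimately show "- (rcoeff_tt p q r x t * h ?w + 2 * rcoeff_t p q r x t * (\<sigma> * h' ?w)
        + rcoeff p q r x t * (\<sigma> * (\<sigma> * E)))
      + (rcoeff_xx p q r x t * h ?w + 2 * rcoeff_x p q r x t * h' ?w + rcoeff p q r x t * E)
      + ?k * (rcoeff p q r x t * h ?w)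
      = 2 * (rcoeff_x p q r x t - \<sigma> * rcoeff_t p q r x t) * h' ?w"
    by (simp only:) (simp add: algebra_simps)
qed

section \<open>Oriented integrals with kernels polynomial in the integration variable\<close>

lemma kg_residual_sum:
  assumes "finite I" "\<And>i. i \<in> I \<Longrightarrow> kg_residual (\<Phi> i) x t (R i)"
  shows "kg_residual (\<lambda>y s. \<Sum>i\<in>I. \<Phi> i y s) x t (\<Sum>i\<in>I. R i)"
  using assms
proof (induction I rule: finite_induct)
  case empty
  have "has_second_derivative (\<lambda>_. 0) 0 s" for s
    by (rule has_second_derivativeI[where h' = "\<lambda>_. 0"]) simp_all
  then show ?case
    unfolding kg_residual_def by (intro exI[of _ 0]) simp
next
  case (insert i I)
  then show ?case
    by (simp add: kg_residual_add)
qed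

text \<open>Since \<open>y\<close> and \<open>s\<close> enter the kernel only through the
  coefficients of powers of \<open>w\<close>, an antiderivative of each \<open>w^i * k w\<close>
  turns the integral into a difference of products of coefficients and waves. No differentiation
  under the integral sign is involved; each endpoint contributes the cross terms of its
  products.\<close>

lemma kg_residual_integral:
  fixes p q r :: "nat \<Rightarrow> real"
  assumes nz: "1 + x^2 - t^2 \<noteq> 0"
    and J: "x - (t - a) \<in> {l<..<u}" "x + (t - a) \<in> {l<..<u}"
    and k: "\<And>w. w \<in> {l<..<u} \<Longrightarrow> k differentiable (at w)"
  shows "kg_residual (\<lambda>y s. LBINT w = y + (s - a)..y - (s - a).
        (\<Sum>i<n. rcoeff (p i) (q i) (r i) y s * w^i) * k w) x t
     ((\<Sum>i<n. 2 * (rcoeff_x (p i) (q i) (r i) x t + rcoeff_t (p i) (q i) (r i) x t)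
          * ((x - (t - a))^i * k (x - (t - a))))
      - (\<Sum>i<n. 2 * (rcoeff_x (p i) (q i) (r i) x t - rcoeff_t (p i) (q i) (r i) x t)
          * ((x + (t - a))^i * k (x + (t - a)))))"
proof -
  have cont_k: "isCont k w" if "w \<in> {l<..<u}" for w
    using k[OF that] by (simp add: differentiable_imp_continuous_within)
  have "l < u"
    using J(1) by simp
  \<comment> \<open>One antiderivative per power serves the whole open interval, so it does not
    change when the endpoints move.\<close>
  then have "\<exists>H. \<forall>w. ereal l < ereal w \<longrightarrow> ereal w < ereal u \<longrightarrow>
      (H has_vector_derivative w^i * k w) (at w)" for i :: nat
    by (intro einterval_antiderivative) (auto intro!: continuous_intros cont_k)
  then obtain H where H_vec:
    "\<And>i w. w \<in> {l<..<u} \<Longrightarrow> (H i has_vector_derivative w^i * k w) (at w)"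
    by simp metis
  then have H: "(H i has_real_derivative w^i * k w) (at w)" if "w \<in> {l<..<u}" for i w
    using that by (simp add: has_real_derivative_iff_has_vector_derivative)
  have H_ev: "\<forall>\<^sub>F w in nhds z. (H i has_real_derivative w^i * k w) (at w)"
    if "z \<in> {l<..<u}" for i z
    using eventually_nhds_in_open[OF open_greaterThanLessThan that]
    by eventually_elim (rule H)
  \<comment> \<open>Second derivatives of the waves built from \<open>H i\<close> require a
    derivative of the integrand at the endpoints.\<close>
  have H': "\<exists>E. ((\<lambda>w. w^i * k w) has_real_derivative E) (at z)" if "z \<in> {l<..<u}" for i z
  proof -
    have "(\<lambda>w. w^i * k w) differentiable (at z)"
      by (intro differentiable_mult differentiable_power differentiable_ident k that)
    then show ?thesis
      by (simp add: real_differentiable_def)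
  qed

  \<comment> \<open>For fixed \<open>y\<close> and \<open>s\<close> the coefficients are constants
    in \<open>w\<close>. The formula holds for either order of the limits, as the integral is
    oriented.\<close>
  have FTC: "(LBINT w = y + (s - a)..y - (s - a). (\<Sum>i<n. rcoeff (p i) (q i) (r i) y s * w^i) * k w)
      = (\<Sum>i<n. rcoeff (p i) (q i) (r i) y s * H i (y - (s - a)))
        - (\<Sum>i<n. rcoeff (p i) (q i) (r i) y s * H i (y + (s - a)))"
    if ys: "y - (s - a) \<in> {l<..<u}" "y + (s - a) \<in> {l<..<u}" for y s
  proof (rule interval_integral_FTC_finite)
    let ?I = "{min (y + (s - a)) (y - (s - a))..max (y + (s - a)) (y - (s - a))}"
    have sub: "?I \<subseteq> {l<..<u}"
      using ys by auto
    then show "continuous_on ?I (\<lambda>w. (\<Sum>i<n. rcoeff (p i) (q i) (r i) y s * w^i) * k w)"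
      by (intro continuous_intros continuous_at_imp_continuous_on ballI cont_k) blast
    show "((\<lambda>z. \<Sum>i<n. rcoeff (p i) (q i) (r i) y s * H i z) has_vector_derivative
        (\<Sum>i<n. rcoeff (p i) (q i) (r i) y s * w^i) * k w) (at w within ?I)"
      if "min (y + (s - a)) (y - (s - a)) \<le> w" "w \<le> max (y + (s - a)) (y - (s - a))" for w
    proof -
      have "w \<in> {l<..<u}"
        using sub that by auto
      then have "((\<lambda>z. \<Sum>i<n. rcoeff (p i) (q i) (r i) y s * H i z) has_real_derivative
          (\<Sum>i<n. rcoeff (p i) (q i) (r i) y s * (w^i * k w))) (at w)"
        by (intro DERIV_sum DERIV_cmult H)
      then show ?thesis
        by (auto simp: has_real_derivative_iff_has_vector_derivative sum_distrib_right mult.assoc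
            intro: has_vector_derivative_at_within)
    qed
  qed

  \<comment> \<open>The upper limit travels with \<open>\<sigma> = -1\<close>, whence the sum of the
    two first derivatives; the lower limit travels with \<open>\<sigma> = 1\<close> and gives their
    difference.\<close>
  have minus: "kg_residual (\<lambda>y s. rcoeff p q r y s * H i (y - (s - a))) x t
      (2 * (rcoeff_x p q r x t + rcoeff_t p q r x t) * ((x - (t - a))^i * k (x - (t - a))))"
    for p q r i
  proof -
    obtain E where "((\<lambda>w. w^i * k w) has_real_derivative E) (at (x - (t - a)))"
      using H' J(1) by blast
    with H_ev[OF J(1)] show ?thesis
      using kg_residual_rcoeff_wave[where \<sigma> = "-1" and a = a and x = x and t = t and h = "H i" and
          h' = "\<lambda>w. w^i * k w" and E = E] nz
      by (simp del: minus_diff_eq)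
  qed
  have plus: "kg_residual (\<lambda>y s. rcoeff p q r y s * H i (y + (s - a))) x t
      (2 * (rcoeff_x p q r x t - rcoeff_t p q r x t) * ((x + (t - a))^i * k (x + (t - a))))"
    for p q r i
  proof -
    obtain E where "((\<lambda>w. w^i * k w) has_real_derivative E) (at (x + (t - a)))"
      using H' J(2) by blast
    with H_ev[OF J(2)] show ?thesis
      using kg_residual_rcoeff_wave[where \<sigma> = "1" and a = a and x = x and t = t and h = "H i" and
          h' = "\<lambda>w. w^i * k w" and E = E] nz by simp
  qed

  have J_ev: "\<forall>\<^sub>F w in nhds (x - (t - a)). w \<in> {l<..<u}" "\<forall>\<^sub>F w in nhds (x + (t - a)). w \<in> {l<..<u}"
    using J by (simp_all only: eventually_nhds_in_open open_greaterThanLessThan)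
  show ?thesis
  proof (rule kg_residual_transform)
    show "kg_residual (\<lambda>y s. (\<Sum>i<n. rcoeff (p i) (q i) (r i) y s * H i (y - (s - a)))
        - (\<Sum>i<n. rcoeff (p i) (q i) (r i) y s * H i (y + (s - a)))) x t
     ((\<Sum>i<n. 2 * (rcoeff_x (p i) (q i) (r i) x t + rcoeff_t (p i) (q i) (r i) x t)
          * ((x - (t - a))^i * k (x - (t - a))))
      - (\<Sum>i<n. 2 * (rcoeff_x (p i) (q i) (r i) x t - rcoeff_t (p i) (q i) (r i) x t)
          * ((x + (t - a))^i * k (x + (t - a)))))"
      by (intro kg_residual_diff kg_residual_sum finite_lessThan minus plus)
  next
    \<comment> \<open>A small change of \<open>t\<close> leaves both limits inside the interval,
      where \<open>FTC\<close> is valid; the same is done for \<open>x\<close> afterwards.\<close>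
    have "\<forall>\<^sub>F s in nhds t. x - (s - a) \<in> {l<..<u}" "\<forall>\<^sub>F s in nhds t. x + (s - a) \<in> {l<..<u}"
      using eventually_wave_t[where P = "\<lambda>w. w \<in> {l<..<u}" and x = x and \<sigma> = "- 1" and t = t and a = a]
        eventually_wave_t[where P = "\<lambda>w. w \<in> {l<..<u}" and x = x and \<sigma> = 1 and t = t and a = a] J_ev
      by (simp_all del: minus_diff_eq greaterThanLessThan_iff)
    then show "\<forall>\<^sub>F s in nhds t.
        (LBINT w = x + (s - a)..x - (s - a). (\<Sum>i<n. rcoeff (p i) (q i) (r i) x s * w^i) * k w)
        = (\<Sum>i<n. rcoeff (p i) (q i) (r i) x s * H i (x - (s - a)))
          - (\<Sum>i<n. rcoeff (p i) (q i) (r i) x s * H i (x + (s - a)))"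
      by eventually_elim (rule FTC)
  next
    have "\<forall>\<^sub>F y in nhds x. y - (t - a) \<in> {l<..<u}" "\<forall>\<^sub>F y in nhds x. y + (t - a) \<in> {l<..<u}"
      using eventually_wave_x[where P = "\<lambda>w. w \<in> {l<..<u}" and x = x and \<sigma> = "- 1" and t = t and a = a]
        eventually_wave_x[where P = "\<lambda>w. w \<in> {l<..<u}" and x = x and \<sigma> = 1 and t = t and a = a] J_ev
      by (simp_all del: minus_diff_eq greaterThanLessThan_iff)
    then show "\<forall>\<^sub>F y in nhds x.
        (LBINT w = y + (t - a)..y - (t - a). (\<Sum>i<n. rcoeff (p i) (q i) (r i) y t * w^i) * k w)
        = (\<Sum>i<n. rcoeff (p i) (q i) (r i) y t * H i (y - (t - a)))
          - (\<Sum>i<n. rcoeff (p i) (q i) (r i) y t * H i (y + (t - a)))"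
      by eventually_elim (rule FTC)
  qed
qed

section \<open>Derivatives of the two kernels along characteristics\<close>

text \<open>A single denominator, independent of \<open>p\<close>, \<open>q\<close> and
  \<open>r\<close>, can be pulled out of a sum over the powers of \<open>w\<close>, so that the
  kernel identities become polynomial ones.\<close>

lemma rcoeff_characteristic:
  assumes "1 + x^2 - t^2 \<noteq> 0"
  shows "rcoeff_x p q r x t - \<sigma> * rcoeff_t p q r x t
    = ((q + 2 * r * x - \<sigma> * (p - 2 * r * t)) * (1 + x^2 - t^2)
        - 2 * (x + \<sigma> * t) * (p * t + q * x + r * (x^2 - t^2 - 1))) / (1 + x^2 - t^2)^2"
proof -
  define D N where "D = 1 + x^2 - t^2" and "N = p * t + q * x + r * (x^2 - t^2 - 1)"
  have "D \<noteq> 0"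
    using assms by (simp add: D_def)
  then show ?thesis
    unfolding rcoeff_x_def rcoeff_t_def D_def[symmetric] N_def[symmetric]
    by (simp add: field_simps power2_eq_square)
qed

text \<open>Entry \<open>i\<close> of the lists belongs to \<open>w^i\<close> in the numerator of
  the kernel of \<open>f\<close>. This kernel is \<open>- 1 / 4\<close> times the derivative in
  \<open>a\<close> of the kernel of \<open>g\<close>. The square on the right cancels the
  denominator \<open>(1 - a^2 + w^2)^2\<close> of that kernel, and the factor
  \<open>- \<sigma>\<close> makes the contributions of the two limits add up instead of
  cancelling.\<close>

lemma f_kernel_characteristic:
  fixes a x t \<sigma> :: real
  defines "w \<equiv> x + \<sigma> * (t - a)"
  assumes \<sigma>: "\<sigma>^2 = 1" and nz: "1 + x^2 - t^2 \<noteq> 0"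
  shows "(\<Sum>i<3. (rcoeff_x ([1 + a^2, 0, 1] ! i) ([0, - 2 * a, 0] ! i) ([a, 0, 0] ! i) x t
      - \<sigma> * rcoeff_t ([1 + a^2, 0, 1] ! i) ([0, - 2 * a, 0] ! i) ([a, 0, 0] ! i) x t) * w^i)
    = - \<sigma> * (1 - a^2 + w^2)^2 / (1 + x^2 - t^2)^2"
proof -
  have "\<sigma> = 1 \<or> \<sigma> = - 1"
    using \<sigma> by (simp add: power2_eq_1_iff)
  then have "(\<Sum>i<3. (([0, - 2 * a, 0] ! i + 2 * [a, 0, 0] ! i * x
        - \<sigma> * ([1 + a^2, 0, 1] ! i - 2 * [a, 0, 0] ! i * t)) * (1 + x^2 - t^2)
      - 2 * (x + \<sigma> * t) * ([1 + a^2, 0, 1] ! i * t + [0, - 2 * a, 0] ! i * x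
        + [a, 0, 0] ! i * (x^2 - t^2 - 1))) * w^i)
    = - \<sigma> * (1 - a^2 + w^2)^2"
    unfolding w_def
    by (elim disjE) (simp_all add: numeral_3_eq_3 algebra_simps power2_eq_square)
  then show ?thesis
    by (simp only: rcoeff_characteristic[OF nz] times_divide_eq_left div_0 flip: sum_divide_distrib)
qed

text \<open>The lists encode the numerator of the kernel of \<open>g\<close>. It differs from
  \<open>(1 + x^2 - t^2) * (1 - a^2 + w^2)\<close> by \<open>2 * ((x - w)^2 - (t - a)^2)\<close> up
  to sign, which vanishes when \<open>w = x + \<sigma> * (t - a)\<close>. Along such a line, with
  \<open>w\<close> fixed, the sum of the coefficients times powers of \<open>w\<close> is therefore
  the constant \<open>1 - a^2 + w^2\<close>.\<close>

lemma g_kernel_characteristic: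
  fixes a x t \<sigma> :: real
  defines "w \<equiv> x + \<sigma> * (t - a)"
  assumes \<sigma>: "\<sigma>^2 = 1" and nz: "1 + x^2 - t^2 \<noteq> 0"
  shows "(\<Sum>i<3. (rcoeff_x ([- 4 * a, 0, 0] ! i) ([0, 4, 0] ! i) ([- (1 + a^2), 0, 1] ! i) x t
      - \<sigma> * rcoeff_t ([- 4 * a, 0, 0] ! i) ([0, 4, 0] ! i) ([- (1 + a^2), 0, 1] ! i) x t) * w^i) = 0"
proof -
  have "\<sigma> = 1 \<or> \<sigma> = - 1"
    using \<sigma> by (simp add: power2_eq_1_iff)
  then have "(\<Sum>i<3. (([0, 4, 0] ! i + 2 * [- (1 + a^2), 0, 1] ! i * x
        - \<sigma> * ([- 4 * a, 0, 0] ! i - 2 * [- (1 + a^2), 0, 1] ! i * t)) * (1 + x^2 - t^2)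
      - 2 * (x + \<sigma> * t) * ([- 4 * a, 0, 0] ! i * t + [0, 4, 0] ! i * x
        + [- (1 + a^2), 0, 1] ! i * (x^2 - t^2 - 1))) * w^i)
    = 0"
    unfolding w_def
    by (elim disjE) (simp_all add: numeral_3_eq_3 algebra_simps power2_eq_square)
  then show ?thesis
    by (simp only: rcoeff_characteristic[OF nz] times_divide_eq_left div_0 flip: sum_divide_distrib)
qed

section \<open>Room around the domain of dependence, and assembly of the solution\<close>

text \<open>By compactness a single radius \<open>e\<close> fits around all points of the segment,
  so the segment can be thickened by \<open>e\<close> at both ends.\<close>

lemma closed_segment_subset_open_interval:
  fixes v w :: real
  assumes "open V" "closed_segment v w \<subseteq> V"
  obtains l u where "closed_segment v w \<subseteq> {l<..<u}" "{l<..<u} \<subseteq> V"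
proof -
  obtain e where "e > 0" and e: "(\<Union>z\<in>closed_segment v w. ball z e) \<subseteq> V"
    using compact_subset_open_imp_ball_epsilon_subset[OF compact_segment assms(1,2)] by metis
  have "z \<in> V" if "z \<in> {min v w - e<..<max v w + e}" for z
  proof -
    \<comment> \<open>The point of the segment nearest to \<open>z\<close>, obtained by
      clamping.\<close>
    define z' where "z' = max (min v w) (min (max v w) z)"
    have "z' \<in> closed_segment v w" "z \<in> ball z' e"
      using that \<open>e > 0\<close>
      by (auto simp: z'_def closed_segment_eq_real_ivl dist_real_def max_def min_def)
    then show ?thesis
      using e by blast
  qed
  moreover have "closed_segment v w \<subseteq> {min v w - e<..<max v w + e}"
    using \<open>e > 0\<close> by (auto simp: closed_segment_eq_real_ivl)
  ultimately show ?thesis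
    using that by blast
qed

theorem proposition5:
  fixes a x t :: real and f g :: "real \<Rightarrow> real" and U :: "real set"
  assumes "open U" and "closed_segment (x - (t - a)) (x + (t - a)) \<subseteq> U"
    and "\<And>w. w \<in> U \<Longrightarrow> f differentiable (at w)"
    and "\<And>w. w \<in> U \<Longrightarrow> deriv f differentiable (at w)"
    and "\<And>w. w \<in> U \<Longrightarrow> g differentiable (at w)"
    and "1 + x^2 - t^2 \<noteq> 0"
    and "\<And>w. w \<in> closed_segment (x - (t - a)) (x + (t - a)) \<Longrightarrow> 1 - a^2 + w^2 \<noteq> 0"
  shows "\<exists>phi_tt phi_xx.
           has_second_derivative (\<lambda>s. phi a f g x s) phi_tt t \<and>
           has_second_derivative (\<lambda>y. phi a f g y t) phi_xx x \<and>
           - phi_tt + phi_xx + 8 / (1 + x^2 - t^2)^2 * phi a f g x t = 0"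
proof -
  let ?v = "x - (t - a)" and ?w = "x + (t - a)" and ?D = "1 + x^2 - t^2"
  note nz = assms(6)
  \<comment> \<open>The regularity of the data and the nonvanishing of the denominators in
    \<open>w\<close> are both wanted on one open interval in which the limits of integration can
    move.\<close>
  have "open {w. 1 - a^2 + w^2 \<noteq> 0}"
    by (intro open_Collect_neq continuous_intros)
  then have "open (U \<inter> {w. 1 - a^2 + w^2 \<noteq> 0})"
    using assms(1) by blast
  moreover have "closed_segment ?v ?w \<subseteq> U \<inter> {w. 1 - a^2 + w^2 \<noteq> 0}"
    using assms(2,7) by blast
  ultimately obtain l u where seg: "closed_segment ?v ?w \<subseteq> {l<..<u}"
    and lu: "{l<..<u} \<subseteq> U \<inter> {w. 1 - a^2 + w^2 \<noteq> 0}"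
    by (rule closed_segment_subset_open_interval)
  have J: "?v \<in> {l<..<u}" "?w \<in> {l<..<u}"
    using seg by (meson ends_in_segment subsetD)+

  \<comment> \<open>\<open>k\<close> and \<open>m\<close> collect the factors depending on
    \<open>w\<close> alone; the rest of each kernel is a quadratic polynomial in \<open>w\<close>
    with coefficients of the form \<open>rcoeff\<close>.\<close>
  define k where "k w = f w / (1 - a^2 + w^2)^2" for w
  define m where "m w = g w / (1 - a^2 + w^2)" for w
  have k: "k differentiable (at w)" if "w \<in> {l<..<u}" for w
    unfolding k_def using that lu assms(3)
    by (intro differentiable_divide derivative_intros) auto
  have m: "m differentiable (at w)" if "w \<in> {l<..<u}" for w
    unfolding m_def using that lu assms(5)
    by (intro differentiable_divide derivative_intros) auto

  have f: "\<exists>E. (deriv f has_real_derivative E) (at z)"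
    "\<forall>\<^sub>F w in nhds z. (f has_real_derivative deriv f w) (at w)"
    if "z \<in> {l<..<u}" for z
  proof -
    show "\<exists>E. (deriv f has_real_derivative E) (at z)"
      using assms(4) lu that by (auto simp: real_differentiable_def)
    have "\<forall>\<^sub>F w in nhds z. w \<in> U"
      using assms(1) lu that by (intro eventually_nhds_in_open) auto
    then show "\<forall>\<^sub>F w in nhds z. (f has_real_derivative deriv f w) (at w)"
      by eventually_elim (metis assms(3) real_differentiable_def DERIV_imp_deriv)
  qed
  have f_minus: "kg_residual (\<lambda>y s. f (y - (s - a))) x t (8 / ?D^2 * f ?v)"
  proof -
    obtain E where "(deriv f has_real_derivative E) (at ?v)"
      using f(1) J(1) by blast
    with f(2)[OF J(1)] show ?thesis
      using kg_residual_wave[where \<sigma> = "-1" and a = a and x = x and t = t and h = f and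
          h' = "deriv f" and E = E] by (simp del: minus_diff_eq)
  qed
  have f_plus: "kg_residual (\<lambda>y s. f (y + (s - a))) x t (8 / ?D^2 * f ?w)"
  proof -
    obtain E where "(deriv f has_real_derivative E) (at ?w)"
      using f(1) J(2) by blast
    with f(2)[OF J(2)] show ?thesis
      using kg_residual_wave[where \<sigma> = 1 and a = a and x = x and t = t and h = f and
          h' = "deriv f" and E = E] by simp
  qed

  let ?p = "\<lambda>i. [1 + a^2, 0, 1] ! i" and ?q = "\<lambda>i. [0, - 2 * a, 0] ! i"
    and ?r = "\<lambda>i. [a, 0, 0] ! i"
  let ?p' = "\<lambda>i. [- 4 * a, 0, 0] ! i" and ?q' = "\<lambda>i. [0, 4, 0] ! i"
    and ?r' = "\<lambda>i. [- (1 + a^2), 0, 1] ! i"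
  have kernel_f: "(t * (1 + a^2 + w^2) + a * (x^2 - 2 * w * x - t^2 - 1))
        / ((1 + x^2 - t^2) * (1 - a^2 + w^2)^2) * f w
      = (\<Sum>i<3. rcoeff (?p i) (?q i) (?r i) x t * w^i) * k w" for x t w
  proof -
    have "t * (1 + a^2 + w^2) + a * (x^2 - 2 * w * x - t^2 - 1)
        = (\<Sum>i<3. (?p i * t + ?q i * x + ?r i * (x^2 - t^2 - 1)) * w^i)"
      by (simp add: numeral_3_eq_3 algebra_simps power2_eq_square)
    then show ?thesis
      by (simp add: rcoeff_def k_def flip: sum_divide_distrib)
  qed
  have kernel_g: "((1 - x^2 + t^2) * (1 + a^2 - w^2) - 4 * a * t + 4 * w * x)
        / ((1 + x^2 - t^2) * (1 - a^2 + w^2)) * g w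
      = (\<Sum>i<3. rcoeff (?p' i) (?q' i) (?r' i) x t * w^i) * m w" for x t w
  proof -
    have "(1 - x^2 + t^2) * (1 + a^2 - w^2) - 4 * a * t + 4 * w * x
        = (\<Sum>i<3. (?p' i * t + ?q' i * x + ?r' i * (x^2 - t^2 - 1)) * w^i)"
      by (simp add: numeral_3_eq_3 algebra_simps power2_eq_square)
    then show ?thesis
      by (simp add: rcoeff_def m_def flip: sum_divide_distrib)
  qed

  \<comment> \<open>Brings the endpoint sums into the form evaluated by the two characteristic
    lemmas.\<close>
  have pull: "(\<Sum>i<n. 2 * c i * (z^i * b)) = 2 * b * (\<Sum>i<n. c i * z^i)"
    for c :: "nat \<Rightarrow> real" and n z b
    by (simp add: sum_distrib_left mult_ac)
  have "kg_residual (\<lambda>y s. LBINT w = y + (s - a)..y - (s - a).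
        (\<Sum>i<3. rcoeff (?p i) (?q i) (?r i) y s * w^i) * k w) x t
      (2 * k ?v * ((1 - a^2 + ?v^2)^2 / ?D^2) + 2 * k ?w * ((1 - a^2 + ?w^2)^2 / ?D^2))"
    using kg_residual_integral[OF nz J k, where n = 3 and p = ?p and q = ?q and r = ?r]
      f_kernel_characteristic[of "-1" x t a] f_kernel_characteristic[of 1 x t a] nz
    unfolding pull by (simp del: minus_diff_eq)
  \<comment> \<open>The endpoints lie in the interval, so the factor \<open>1 - a^2 + w^2\<close> is
    nonzero there and cancels against the denominator of \<open>k\<close>.\<close>
  moreover have "2 * k ?v * ((1 - a^2 + ?v^2)^2 / ?D^2) = 2 / ?D^2 * f ?v"
    "2 * k ?w * ((1 - a^2 + ?w^2)^2 / ?D^2) = 2 / ?D^2 * f ?w"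
    using J lu by (auto simp: k_def)
  ultimately have int_f: "kg_residual (\<lambda>y s. LBINT w = y + (s - a)..y - (s - a).
      (\<Sum>i<3. rcoeff (?p i) (?q i) (?r i) y s * w^i) * k w) x t (2 / ?D^2 * f ?v + 2 / ?D^2 * f ?w)"
    by (simp only:)
  have int_g: "kg_residual (\<lambda>y s. LBINT w = y + (s - a)..y - (s - a).
      (\<Sum>i<3. rcoeff (?p' i) (?q' i) (?r' i) y s * w^i) * m w) x t 0"
    using kg_residual_integral[OF nz J m, where n = 3 and p = ?p' and q = ?q' and r = ?r']
      g_kernel_characteristic[of "-1" x t a] g_kernel_characteristic[of 1 x t a] nz
    unfolding pull by (simp del: minus_diff_eq)

  have "phi a f g = (\<lambda>y s. 1 / 2 * (f (y - (s - a)) + f (y + (s - a)))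
     - 2 * (LBINT w = y + (s - a)..y - (s - a).
         (\<Sum>i<3. rcoeff (?p i) (?q i) (?r i) y s * w^i) * k w)
     - 1 / 2 * (LBINT w = y + (s - a)..y - (s - a).
         (\<Sum>i<3. rcoeff (?p' i) (?q' i) (?r' i) y s * w^i) * m w))"
    unfolding phi_def[abs_def] kernel_f kernel_g by simp
  \<comment> \<open>The half sum of the waves leaves \<open>4 / ?D^2\<close> times
    \<open>f ?v + f ?w\<close>, the doubled integral of \<open>f\<close> removes exactly this
    amount, and the integral of \<open>g\<close> contributes nothing.\<close>
  moreover have "kg_residual \<dots> x t (1 / 2 * (8 / ?D^2 * f ?v + 8 / ?D^2 * f ?w)
      - 2 * (2 / ?D^2 * f ?v + 2 / ?D^2 * f ?w) - 1 / 2 * 0)"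
    by (intro kg_residual_diff kg_residual_cmult kg_residual_add f_minus f_plus int_f int_g)
  moreover have "1 / 2 * (8 / ?D^2 * f ?v + 8 / ?D^2 * f ?w)
      - 2 * (2 / ?D^2 * f ?v + 2 / ?D^2 * f ?w) - 1 / 2 * 0 = 0"
    by (simp add: field_simps)
  ultimately have "kg_residual (phi a f g) x t 0"
    by (simp only:)
  then show ?thesis
    by (simp add: kg_residual_def)
qed

end
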